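(* If $X$ is a nondegenerate unicoherent continuum, then $CB(X)$ is a $G_\delta$-subset of $C(X)$.
   Context: All continua are metric: a continuum is a compact connected metric space; it is nondegenerate if it has more than one point. A continuum $X$ is unicoherent if $A\cap B$ is connected whenever $X=A\cup B$ with $A,B$ subcontinua of $X$. $2^X$ is the hyperspace of all nonempty closed subsets of $X$ and $C(X)=\{A\in 2^X: A \text{ is connected}\}$, both with the Hausdorff metric. $CB(X)=\{A\in C(X)\setminus\{X\}: Bd(A)\text{ is connected}\}$, where $Bd(A)=A\cap\overline{X\setminus A}$ is the boundary of $A$ in $X$. *)

theory Defs
  imports "HOL-Analysis.Analysis"
begin

text \<open>A metric continuum is represented as a subset \<open>X\<close> of a type of class
  \<^class>\<open>metric_space\<close>, with the restricted metric. All topological notions are relative to \<open>X\<close>;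
  compactness and connectedness do not depend on the ambient space.\<close>

definition continuum :: "'a::metric_space set \<Rightarrow> bool" where
  "continuum X \<longleftrightarrow> X \<noteq> {} \<and> compact X \<and> connected X"

text \<open>Unicoherence is the library's \<^const>\<open>unicoherent\<close>: for compact \<open>X\<close>, nonempty connected
  \<open>closedin (top_of_set X)\<close> sets are exactly the subcontinua, and an empty set contributes only the
  trivial case \<open>A \<inter> B = {}\<close>.\<close>

lemma unicoherent_continuum_iff:
  assumes "continuum X"
  shows "unicoherent X \<longleftrightarrow>
    (\<forall>A B. continuum A \<and> continuum B \<and> X = A \<union> B \<longrightarrow> connected (A \<inter> B))"
proof -
  have X: "compact X" using assms by (simp add: continuum_def)
  have *: "closedin (top_of_set X) A \<longleftrightarrow> compact A" if "A \<subseteq> X" for A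
    using that X closedin_compact compact_imp_closed closed_subset by metis
  show ?thesis
    unfolding unicoherent_def continuum_def
    by (metis * Un_upper1 Un_upper2 connected_empty inf_bot_left inf_bot_right)
qed

definition hyperspace_closed :: "'a::metric_space set \<Rightarrow> 'a set set" where
  "hyperspace_closed X = {A. A \<noteq> {} \<and> closedin (top_of_set X) A}"

definition hyperspace_C :: "'a::metric_space set \<Rightarrow> 'a set set" where
  "hyperspace_C X = {A \<in> hyperspace_closed X. connected A}"

text \<open>The value \<open>0\<close> outside nonempty bounded sets is a totalization: \<^locale>\<open>Metric_space\<close>
  requires nonnegativity and symmetry for all arguments. Nonempty closed subsets of a compact set
  are nonempty and bounded.\<close>

definition hausdorff_dist :: "'a::metric_space set \<Rightarrow> 'a set \<Rightarrow> real" where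
  "hausdorff_dist A B =
    (if A \<noteq> {} \<and> B \<noteq> {} \<and> bounded A \<and> bounded B
     then max (SUP a\<in>A. infdist a B) (SUP b\<in>B. infdist b A) else 0)"

definition hyperspace_C_topology :: "'a::metric_space set \<Rightarrow> 'a set topology" where
  "hyperspace_C_topology X = Metric_space.mtopology (hyperspace_C X) hausdorff_dist"

definition boundary_in :: "'a::metric_space set \<Rightarrow> 'a set \<Rightarrow> 'a set" where
  "boundary_in X A = A \<inter> (top_of_set X closure_of (X - A))"

definition hyperspace_CB :: "'a::metric_space set \<Rightarrow> 'a set set" where
  "hyperspace_CB X = {A \<in> hyperspace_C X - {X}. connected (boundary_in X A)}"

text \<open>\<^const>\<open>Metric_space.mtopology\<close> is only meaningful on a metric space, so we check that
  the Hausdorff distance is a metric.\<close>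

lemma bdd_above_infdist:
  assumes "bounded A" "B \<noteq> {}"
  shows "bdd_above ((\<lambda>a. infdist a B) ` A)"
proof -
  obtain b where b: "b \<in> B" using assms by blast
  obtain e where "\<forall>a\<in>A. dist b a \<le> e"
    using assms(1) bounded_any_center by blast
  then have "\<forall>a\<in>A. infdist a B \<le> e"
    using infdist_le[OF b] by (metis dist_commute order_trans)
  then show ?thesis by (auto simp: bdd_above_def)
qed

lemma hausdorff_dist_le_iff:
  assumes "bounded A" "bounded B" "A \<noteq> {}" "B \<noteq> {}"
  shows "hausdorff_dist A B \<le> e \<longleftrightarrow> (\<forall>a\<in>A. infdist a B \<le> e) \<and> (\<forall>b\<in>B. infdist b A \<le> e)"
  using assms by (simp add: hausdorff_dist_def cSUP_le_iff bdd_above_infdist)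

lemma hausdorff_dist_nonneg: "0 \<le> hausdorff_dist A B"
proof (cases "A \<noteq> {} \<and> B \<noteq> {} \<and> bounded A \<and> bounded B")
  case True
  then obtain a where "a \<in> A" by blast
  moreover have "infdist a B \<le> hausdorff_dist A B"
    using True \<open>a \<in> A\<close> hausdorff_dist_le_iff[of A B] by blast
  ultimately show ?thesis using infdist_nonneg order_trans by blast
qed (auto simp: hausdorff_dist_def)

lemma hausdorff_dist_commute: "hausdorff_dist A B = hausdorff_dist B A"
  by (auto simp: hausdorff_dist_def max.commute)

lemma infdist_triangle_hausdorff_dist:
  assumes "bounded A" "bounded B" "A \<noteq> {}" "B \<noteq> {}"
  shows "infdist x B \<le> infdist x A + hausdorff_dist A B"
proof -
  have "infdist x B - hausdorff_dist A B \<le> dist x a" if "a \<in> A" for a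
  proof -
    have "infdist x B \<le> infdist a B + dist x a" by (rule infdist_triangle)
    moreover have "infdist a B \<le> hausdorff_dist A B"
      using that assms hausdorff_dist_le_iff[of A B] by blast
    ultimately show ?thesis by linarith
  qed
  then have "infdist x B - hausdorff_dist A B \<le> infdist x A"
    using assms by (auto simp: infdist_notempty intro!: cINF_greatest)
  then show ?thesis by linarith
qed

lemma Metric_space_hausdorff_dist:
  assumes "compact X"
  shows "Metric_space (hyperspace_closed X) hausdorff_dist"
proof
  have cpt: "compact A" and ne: "A \<noteq> {}" if "A \<in> hyperspace_closed X" for A
    using that assms closedin_compact by (auto simp: hyperspace_closed_def)
  note bdd = compact_imp_bounded[OF cpt]
  show "0 \<le> hausdorff_dist A B" "hausdorff_dist A B = hausdorff_dist B A" for A B :: "'a set"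
    by (rule hausdorff_dist_nonneg hausdorff_dist_commute)+
  show "hausdorff_dist A B = 0 \<longleftrightarrow> A = B"
    if AB: "A \<in> hyperspace_closed X" "B \<in> hyperspace_closed X" for A B
  proof -
    have cl: "closure A = A" "closure B = B"
      using AB by (simp_all add: cpt compact_imp_closed)
    have "hausdorff_dist A B = 0 \<longleftrightarrow> (\<forall>a\<in>A. infdist a B \<le> 0) \<and> (\<forall>b\<in>B. infdist b A \<le> 0)"
      using hausdorff_dist_le_iff[OF bdd bdd ne ne, OF AB AB, of 0] hausdorff_dist_nonneg[of A B]
      by linarith
    also have "\<dots> \<longleftrightarrow> (\<forall>a\<in>A. a \<in> closure B) \<and> (\<forall>b\<in>B. b \<in> closure A)"
      using in_closure_iff_infdist_zero[OF ne[OF AB(1)]] in_closure_iff_infdist_zero[OF ne[OF AB(2)]]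
      by (metis antisym infdist_nonneg order_refl)
    finally show ?thesis using cl by auto
  qed
  show "hausdorff_dist A C \<le> hausdorff_dist A B + hausdorff_dist B C"
    if ABC: "A \<in> hyperspace_closed X" "B \<in> hyperspace_closed X" "C \<in> hyperspace_closed X" for A B C
  proof -
    have AB: "\<forall>a\<in>A. infdist a B \<le> hausdorff_dist A B"
      using hausdorff_dist_le_iff[OF bdd bdd ne ne, OF ABC(1,2,1,2)] by blast
    have CB: "\<forall>c\<in>C. infdist c B \<le> hausdorff_dist B C"
      using hausdorff_dist_le_iff[OF bdd bdd ne ne, OF ABC(2,3,2,3)] by blast
    have 1: "infdist a C \<le> hausdorff_dist A B + hausdorff_dist B C" if "a \<in> A" for a
      using AB[rule_format, OF that] infdist_triangle_hausdorff_dist[OF bdd bdd ne ne, OF ABC(2,3,2,3), of a]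
      by linarith
    have 2: "infdist c A \<le> hausdorff_dist A B + hausdorff_dist B C" if "c \<in> C" for c
      using CB[rule_format, OF that] infdist_triangle_hausdorff_dist[OF bdd bdd ne ne, OF ABC(2,1,2,1), of c]
      unfolding hausdorff_dist_commute[of B A] by linarith
    show ?thesis
      using 1 2 hausdorff_dist_le_iff[OF bdd bdd ne ne, OF ABC(1,3,1,3)] by blast
  qed
qed

lemma Metric_space_hyperspace_C:
  assumes "compact X"
  shows "Metric_space (hyperspace_C X) hausdorff_dist"
  by (rule Metric_space.subspace[OF Metric_space_hausdorff_dist[OF assms]])
    (auto simp: hyperspace_C_def)

end

theory Submission
  imports Defs
begin

text \<open>By unicoherence, a subcontinuum \<open>A \<noteq> X\<close> has connected boundary iff the closure of \<open>X - A\<close> is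
  connected. Compactness of \<open>X\<close> yields a countable family of closed sets separating any two disjoint
  compact subsets of \<open>X\<close>, so the closure of \<open>X - A\<close> is disconnected iff some disjoint pair \<open>F, G\<close> from
  that family covers \<open>X - A\<close> with both \<open>F\<close> and \<open>G\<close> meeting \<open>X - A\<close>. For a fixed pair the covering
  condition is closed in \<open>A\<close> and the meeting conditions are open, because \<open>{A. Y \<subseteq> A}\<close> is closed in the
  hyperspace for every \<open>Y\<close>. Hence the complement of \<open>CB(X)\<close> is a countable union of \<open>F\<^sub>\<sigma>\<close> sets.\<close>

text \<open>The members are unions of closed balls of radius \<open>e n\<close> centred at points of
  a finite net \<open>K n\<close>; each \<open>n\<close> gives finitely many. Disjoint compact sets
  lie a positive distance apart, so a fine enough net thickens them to disjoint members.\<close>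

lemma compact_countable_closed_separating_family:
  fixes X :: "'a::metric_space set"
  assumes "compact X"
  obtains \<F> where "countable \<F>" "\<And>F. F \<in> \<F> \<Longrightarrow> closed F"
    "\<And>P Q. \<lbrakk>compact P; compact Q; P \<subseteq> X; Q \<subseteq> X; P \<inter> Q = {}\<rbrakk>
      \<Longrightarrow> \<exists>F\<in>\<F>. \<exists>G\<in>\<F>. F \<inter> G = {} \<and> P \<subseteq> F \<and> Q \<subseteq> G"
proof -
  define e where "e n = inverse (real (Suc n))" for n
  have "\<exists>k. finite k \<and> k \<subseteq> X \<and> X \<subseteq> (\<Union>x\<in>k. ball x (e n))" for n
    using seq_compact_imp_totally_bounded[of X] assms by (simp add: e_def compact_imp_seq_compact)
  then obtain K where K: "finite (K n)" "X \<subseteq> (\<Union>x\<in>K n. ball x (e n))" for n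
    by metis
  define \<F> where "\<F> = (\<Union>n. (\<lambda>S. \<Union>k\<in>S. cball k (e n)) ` Pow (K n))"
  show thesis
  proof
    show "countable \<F>"
    proof -
      have "countable ((\<lambda>S. \<Union>k\<in>S. cball k (e n)) ` Pow (K n))" for n
        using K(1) by (simp add: countable_finite)
      then show ?thesis
        unfolding \<F>_def by simp
    qed
    show "closed F" if "F \<in> \<F>" for F
      using that K(1) unfolding \<F>_def by (auto intro!: closed_UN dest: finite_subset)
  next
    fix P Q assume PQ: "compact P" "compact Q" "P \<subseteq> X" "Q \<subseteq> X" "P \<inter> Q = {}"
    obtain \<delta> where \<delta>: "\<delta> > 0" "\<And>x y. \<lbrakk>x \<in> P; y \<in> Q\<rbrakk> \<Longrightarrow> \<delta> \<le> dist x y"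
    \<comment> \<open>\<open>setdist\<close> is 0 by convention when a set is empty, so that case is
      split off; any positive \<delta> serves there.\<close>
    proof (cases "P = {} \<or> Q = {}")
      case True
      then show thesis
        using that[of 1] by auto
    next
      case False
      then have "setdist P Q > 0"
        using setdist_eq_0_compact_closed[of P Q] setdist_pos_le[of P Q] PQ compact_imp_closed
        by (metis less_eq_real_def)
      then show thesis
        using that setdist_le_dist by blast
    qed
    \<comment> \<open>The factor 4 counts the links of the chain \<open>p\<close>, \<open>k\<close>,
      \<open>z\<close>, \<open>l\<close>, \<open>q\<close> that a common point \<open>z\<close> of
      the two thickenings would create, each of length at most \<open>e n\<close>.\<close>
    obtain n where n: "e n < \<delta> / 4"
      using reals_Archimedean[of "\<delta> / 4"] \<delta>(1) by (auto simp: e_def)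
    define N where "N R = (\<Union>k\<in>{k \<in> K n. \<exists>r\<in>R. dist k r < e n}. cball k (e n))" for R
    have "N R \<in> \<F>" for R
      unfolding N_def \<F>_def by auto
    moreover have "R \<subseteq> N R" if "R \<subseteq> X" for R
    proof
      fix r assume "r \<in> R"
      with that K(2)[of n] obtain k where "k \<in> K n" "dist k r < e n"
        by auto
      then show "r \<in> N R"
        using \<open>r \<in> R\<close> by (force simp: N_def)
    qed
    moreover have "N P \<inter> N Q = {}"
    proof (rule ccontr)
      assume "N P \<inter> N Q \<noteq> {}"
      then obtain z k p l q where "p \<in> P" "q \<in> Q" and
        "dist k p < e n" "dist k z \<le> e n" "dist l q < e n" "dist l z \<le> e n"
        unfolding N_def by auto
      moreover have "dist p q \<le> dist k p + dist k z + dist l z + dist l q"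
        using dist_triangle[of p q k] dist_triangle[of k q z] dist_triangle[of z q l]
        by (simp add: dist_commute)
      ultimately show False
        using \<delta>(2)[of p q] n by linarith
    qed
    ultimately show "\<exists>F\<in>\<F>. \<exists>G\<in>\<F>. F \<inter> G = {} \<and> P \<subseteq> F \<and> Q \<subseteq> G"
      using PQ by metis
  qed
qed

text \<open>A closed cover of \<open>U\<close> also covers its closure, so the test can be made on
  \<open>U\<close> itself. Conversely, the pieces of a separation of the closure are compact and can
  be enlarged to disjoint members of the family.\<close>

lemma connected_closure_iff_separating_family:
  fixes X :: "'a::metric_space set"
  assumes X: "compact X" "U \<subseteq> X"
    and closed: "\<And>F. F \<in> \<F> \<Longrightarrow> closed F"
    and sep: "\<And>P Q. \<lbrakk>compact P; compact Q; P \<subseteq> X; Q \<subseteq> X; P \<inter> Q = {}\<rbrakk>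
      \<Longrightarrow> \<exists>F\<in>\<F>. \<exists>G\<in>\<F>. F \<inter> G = {} \<and> P \<subseteq> F \<and> Q \<subseteq> G"
  shows "connected (closure U) \<longleftrightarrow>
    (\<forall>F\<in>\<F>. \<forall>G\<in>\<F>. F \<inter> G = {} \<longrightarrow> U \<subseteq> F \<union> G \<longrightarrow> U \<inter> F = {} \<or> U \<inter> G = {})"
    (is "?L \<longleftrightarrow> ?R")
proof
  assume L: ?L
  show ?R
  proof (intro ballI impI)
    fix F G assume FG: "F \<in> \<F>" "G \<in> \<F>" "F \<inter> G = {}" "U \<subseteq> F \<union> G"
    have "closure U \<subseteq> F \<union> G"
      using FG closed by (intro closure_minimal closed_Un) auto
    then have "F \<inter> closure U = {} \<or> G \<inter> closure U = {}"
      using connected_closedD[OF L, of F G] FG closed by auto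
    then show "U \<inter> F = {} \<or> U \<inter> G = {}"
      using closure_subset by blast
  qed
next
  assume R: ?R
  have clX: "closure U \<subseteq> X"
    using X by (simp add: closure_minimal compact_imp_closed)
  show ?L
  proof (rule ccontr)
    assume "\<not> ?L"
    then obtain P Q where PQ: "closed P" "closed Q" "P \<noteq> {}" "Q \<noteq> {}"
      "P \<union> Q = closure U" "P \<inter> Q = {}"
      by (auto simp: connected_closed_set)
    then have sub: "P \<subseteq> X" "Q \<subseteq> X"
      using clX by auto
    then have "compact P" "compact Q"
      using PQ X compact_Int_closed by (metis inf.absorb_iff2)+
    with sep sub PQ obtain F G where FG: "F \<in> \<F>" "G \<in> \<F>" "F \<inter> G = {}" "P \<subseteq> F" "Q \<subseteq> G"
      by metis
    have "U \<subseteq> F \<union> G"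
      using FG PQ closure_subset by blast
    with R FG have "U \<inter> F = {} \<or> U \<inter> G = {}"
      by blast
    \<comment> \<open>If \<open>U\<close> lies in \<open>G\<close>, so does its closure, which
      contains \<open>P\<close>; then \<open>P\<close> lies in both \<open>F\<close> and
      \<open>G\<close> and is empty. The other case is symmetric.\<close>
    then have "U \<subseteq> G \<or> U \<subseteq> F"
      using \<open>U \<subseteq> F \<union> G\<close> by blast
    then have "closure U \<subseteq> G \<or> closure U \<subseteq> F"
      using FG closed by (metis closure_minimal)
    then show False
      using PQ FG by blast
  qed
qed

text \<open>\<open>A\<close> and the closure of \<open>X - A\<close> cover \<open>X\<close> and meet
  exactly in the boundary, so unicoherence gives one direction. The converse rests on the
  connectedness of \<open>X\<close>.\<close>

lemma connected_boundary_in_iff: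
  fixes X :: "'a::metric_space set"
  assumes X: "continuum X" "unicoherent X" and A: "A \<in> hyperspace_C X" "A \<noteq> X"
  shows "connected (boundary_in X A) \<longleftrightarrow> connected (closure (X - A))"
proof -
  have clX: "closed X" and conX: "connected X"
    using X compact_imp_closed by (auto simp: continuum_def)
  have A': "closedin (top_of_set X) A" "connected A" "A \<noteq> {}" "closed A" "A \<subseteq> X"
    using A clX closedin_closed_trans[of X A] closedin_imp_subset[of euclidean X A]
    by (simp_all add: hyperspace_C_def hyperspace_closed_def)
  \<comment> \<open>As \<open>X\<close> is closed, the closure relative to \<open>X\<close> agrees
    with the ambient one.\<close>
  have clU: "closure (X - A) \<subseteq> X"
    using clX by (simp add: closure_minimal)
  then have bd: "boundary_in X A = A \<inter> closure (X - A)"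
    by (auto simp: boundary_in_def closure_of_subtopology Int_absorb1)
  have cover: "X = A \<union> closure (X - A)"
    using A' clU closure_subset by blast
  show ?thesis
  proof
    assume "connected (closure (X - A))"
    moreover have "closedin (top_of_set X) (closure (X - A))"
      using clU by (simp add: closed_subset)
    ultimately show "connected (boundary_in X A)"
      unfolding bd using unicoherentD[OF X(2)] A' cover by metis
  next
    assume con: "connected (boundary_in X A)"
    show "connected (closure (X - A))"
    proof (rule ccontr)
      assume "\<not> connected (closure (X - A))"
      then obtain P Q where PQ: "closed P" "closed Q" "P \<noteq> {}" "Q \<noteq> {}"
        "P \<union> Q = closure (X - A)" "P \<inter> Q = {}"
        by (auto simp: connected_closed_set)
      \<comment> \<open>The connected boundary misses one of the two pieces, and that piece is then clopen in \<open>X\<close>.\<close>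
      have no: False if "closed S" "closed T" "T \<noteq> {}" "S \<union> T = closure (X - A)"
          "S \<inter> T = {}" "T \<inter> boundary_in X A = {}" for S T
      proof -
        have "(A \<union> S) \<inter> T = {}" "(A \<union> S) \<union> T = X"
          using that cover unfolding bd by blast+
        then show False
          using conX that A' clX unfolding connected_closed_set[OF clX]
          by (metis closed_Un Un_empty)
      qed
      have "boundary_in X A \<subseteq> P \<union> Q"
        using PQ bd by auto
      then have "P \<inter> boundary_in X A = {} \<or> Q \<inter> boundary_in X A = {}"
        using connected_closedD[OF con, of P Q] PQ by auto
      then show False
        using no[of P Q] no[of Q P] PQ by (auto simp: Un_commute Int_commute)
    qed
  qed
qed

lemma topspace_hyperspace_C_topology:
  "compact X \<Longrightarrow> topspace (hyperspace_C_topology X) = hyperspace_C X"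
  by (simp add: hyperspace_C_topology_def Metric_space.topspace_mtopology Metric_space_hyperspace_C)

text \<open>The distance from \<open>x\<close> to a set is 1-Lipschitz in the Hausdorff distance, so
  the ball of radius \<open>infdist x A\<close> around \<open>A\<close> contains only sets that miss
  \<open>x\<close>.\<close>

lemma openin_hyperspace_C_not_mem:
  fixes X :: "'a::metric_space set"
  assumes "compact X"
  shows "openin (hyperspace_C_topology X) {A \<in> hyperspace_C X. x \<notin> A}"
proof -
  interpret Metric_space "hyperspace_C X" hausdorff_dist
    using assms by (rule Metric_space_hyperspace_C)
  have cpt: "compact A" "A \<noteq> {}" if "A \<in> hyperspace_C X" for A
    using that assms closedin_compact by (auto simp: hyperspace_C_def hyperspace_closed_def)
  have "\<exists>r>0. mball A r \<subseteq> {A \<in> hyperspace_C X. x \<notin> A}"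
    if A: "A \<in> hyperspace_C X" "x \<notin> A" for A
  proof (intro exI conjI subsetI)
    show "0 < infdist x A"
      using A cpt by (simp add: infdist_pos_not_in_closed compact_imp_closed)
    fix B assume "B \<in> mball A (infdist x A)"
    then have B: "B \<in> hyperspace_C X" "hausdorff_dist B A < infdist x A"
      by (auto simp: hausdorff_dist_commute)
    then have "infdist x A \<le> infdist x B + hausdorff_dist B A"
      using A cpt by (intro infdist_triangle_hausdorff_dist) (auto simp: compact_imp_bounded)
    then have "x \<notin> B"
      using B by (auto simp: infdist_zero)
    then show "B \<in> {A \<in> hyperspace_C X. x \<notin> A}"
      using B by simp
  qed
  then show ?thesis
    by (auto simp: hyperspace_C_topology_def openin_mtopology)
qed

lemma openin_hyperspace_C_not_superset:
  fixes X :: "'a::metric_space set"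
  assumes "compact X"
  shows "openin (hyperspace_C_topology X) {A \<in> hyperspace_C X. \<not> Y \<subseteq> A}"
proof -
  have "{A \<in> hyperspace_C X. \<not> Y \<subseteq> A} = (\<Union>x\<in>Y. {A \<in> hyperspace_C X. x \<notin> A})"
    by auto
  then show ?thesis
    using openin_hyperspace_C_not_mem[OF assms] by auto
qed

lemma closedin_hyperspace_C_superset:
  fixes X :: "'a::metric_space set"
  assumes "compact X"
  shows "closedin (hyperspace_C_topology X) {A \<in> hyperspace_C X. Y \<subseteq> A}"
proof -
  have "hyperspace_C X - {A \<in> hyperspace_C X. Y \<subseteq> A} = {A \<in> hyperspace_C X. \<not> Y \<subseteq> A}"
    by auto
  then show ?thesis
    using openin_hyperspace_C_not_superset[OF assms]
    by (auto simp: closedin_def topspace_hyperspace_C_topology[OF assms])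
qed

theorem proposition1p3:
  fixes X :: "'a::metric_space set"
  assumes "continuum X" and "\<exists>x\<in>X. \<exists>y\<in>X. x \<noteq> y" and "unicoherent X"
  shows "gdelta_in (hyperspace_C_topology X) (hyperspace_CB X)"
proof -
  have X: "compact X"
    using assms by (simp add: continuum_def)
  obtain \<F> where \<F>: "countable \<F>" "\<And>F. F \<in> \<F> \<Longrightarrow> closed F"
    "\<And>P Q. \<lbrakk>compact P; compact Q; P \<subseteq> X; Q \<subseteq> X; P \<inter> Q = {}\<rbrakk>
      \<Longrightarrow> \<exists>F\<in>\<F>. \<exists>G\<in>\<F>. F \<inter> G = {} \<and> P \<subseteq> F \<and> Q \<subseteq> G"
    using compact_countable_closed_separating_family[OF X] by blast
  define \<D> where "\<D> = {(F, G) \<in> \<F> \<times> \<F>. F \<inter> G = {}}"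
  \<comment> \<open>The criterion for one pair, as a disjunction: \<open>F\<close> and
    \<open>G\<close> fail to cover \<open>X - A\<close>, or one of them misses it. Each clause is
    rewritten as \<open>Y \<subseteq> A\<close> or its negation, with \<open>Y\<close> independent
    of \<open>A\<close>.\<close>
  define S where "S = (\<lambda>(F, G). {A \<in> hyperspace_C X. \<not> X - (F \<union> G) \<subseteq> A}
    \<union> {A \<in> hyperspace_C X. X \<inter> F \<subseteq> A} \<union> {A \<in> hyperspace_C X. X \<inter> G \<subseteq> A})"
  \<comment> \<open>The inserted set encodes \<open>A \<noteq> X\<close>; it also keeps the family
    nonempty and its intersection inside \<open>hyperspace_C X\<close>.\<close>
  let ?T = "insert {A \<in> hyperspace_C X. \<not> X \<subseteq> A} (S ` \<D>)"
  have metr: "metrizable_space (hyperspace_C_topology X)"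
    unfolding hyperspace_C_topology_def
    by (intro Metric_space.metrizable_space_mtopology Metric_space_hyperspace_C X)
  have sub: "A \<subseteq> X" if "A \<in> hyperspace_C X" for A
    using that closedin_imp_subset by (auto simp: hyperspace_C_def hyperspace_closed_def)
  have eq: "hyperspace_CB X = \<Inter> ?T"
  proof (rule set_eqI)
    fix A
    show "A \<in> hyperspace_CB X \<longleftrightarrow> A \<in> \<Inter> ?T"
    proof (cases "A \<in> hyperspace_C X \<and> A \<noteq> X")
      case True
      have "A \<in> hyperspace_CB X \<longleftrightarrow> connected (closure (X - A))"
        using True connected_boundary_in_iff[OF assms(1,3)] by (simp add: hyperspace_CB_def)
      also have "\<dots> \<longleftrightarrow> (\<forall>F\<in>\<F>. \<forall>G\<in>\<F>. F \<inter> G = {} \<longrightarrow> X - A \<subseteq> F \<union> G \<longrightarrow>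
          (X - A) \<inter> F = {} \<or> (X - A) \<inter> G = {})"
        by (rule connected_closure_iff_separating_family[OF X Diff_subset \<F>(2,3)])
      also have "\<dots> \<longleftrightarrow> (\<forall>F\<in>\<F>. \<forall>G\<in>\<F>. F \<inter> G = {} \<longrightarrow> A \<in> S (F, G))"
      proof -
        have "X - A \<subseteq> F \<union> G \<longleftrightarrow> X - (F \<union> G) \<subseteq> A" "(X - A) \<inter> F = {} \<longleftrightarrow> X \<inter> F \<subseteq> A" for F G
          by blast+
        then show ?thesis
          using True unfolding S_def by auto
      qed
      also have "\<dots> \<longleftrightarrow> A \<in> \<Inter> (S ` \<D>)"
        unfolding \<D>_def by auto
      also have "\<dots> \<longleftrightarrow> A \<in> \<Inter> ?T"
        using True sub by auto
      finally show ?thesis .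
    next
      case False
      then show ?thesis
        by (auto simp: hyperspace_CB_def)
    qed
  qed
  have "countable ?T"
  proof -
    have "\<D> \<subseteq> \<F> \<times> \<F>"
      by (auto simp: \<D>_def)
    then have "countable \<D>"
      by (rule countable_subset) (simp add: \<F>(1))
    then show ?thesis
      by simp
  qed
  \<comment> \<open>Each \<open>S (F, G)\<close> is the union of an open set and two closed sets;
    closed sets are G-delta by metrizability, and finite unions preserve G-delta.\<close>
  moreover have "gdelta_in (hyperspace_C_topology X) W" if "W \<in> ?T" for W
    using that unfolding S_def
    by (auto intro!: gdelta_in_Un open_imp_gdelta_in[OF openin_hyperspace_C_not_superset[OF X]]
        closed_imp_gdelta_in[OF metr closedin_hyperspace_C_superset[OF X]])
  ultimately show ?thesis
    unfolding eq by (intro gdelta_in_Inter) auto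
qed

end
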